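(* Let $P=(X,\prec)$ be a finite poset. For every $x\in X$ and all integers $t>a>1$, $$\Omega(P,t;x,a+1)\cdot\Omega(P,t;x,a)\ \ge\ \Omega(P,t+1;x,a+1)\cdot\Omega(P,t-1;x,a).$$
   Context: For an integer $t\ge1$ and integer $a$, $\Omega(P,t;x,a)$ is the number of maps $g:X\to[t]$ with $g(u)\le g(v)$ whenever $u\prec v$, and $g(x)=a$. *)

theory Defs
  imports Main "HOL-Library.FuncSet"
begin

text \<open>
  A poset is given, as in the source, by its strict order \<open>\<prec>\<close> on a carrier set \<open>X\<close>.
\<close>

definition strict_poset_on :: "'a set \<Rightarrow> ('a \<Rightarrow> 'a \<Rightarrow> bool) \<Rightarrow> bool" where
  "strict_poset_on X prec \<longleftrightarrow> irreflp_on X prec \<and> transp_on X prec"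

text \<open>
  Maps \<open>X \<rightarrow> [t]\<close>, with \<open>[t] = {1, \<dots>, t}\<close>, are extensional functions (\<open>undefined\<close> outside \<open>X\<close>),
  so that each map on \<open>X\<close> is counted exactly once.
\<close>

definition order_preserving_maps :: "'a set \<Rightarrow> ('a \<Rightarrow> 'a \<Rightarrow> bool) \<Rightarrow> int \<Rightarrow> ('a \<Rightarrow> int) set" where
  "order_preserving_maps X prec t =
     {g \<in> X \<rightarrow>\<^sub>E {1..t}. \<forall>u\<in>X. \<forall>v\<in>X. prec u v \<longrightarrow> g u \<le> g v}"

definition Omega :: "'a set \<Rightarrow> ('a \<Rightarrow> 'a \<Rightarrow> bool) \<Rightarrow> int \<Rightarrow> 'a \<Rightarrow> int \<Rightarrow> nat" where
  "Omega X prec t x a = card {g \<in> order_preserving_maps X prec t. g x = a}"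

end

theory Submission
  imports Defs
begin

text \<open>
  Shift the maps counted by \<open>Omega (t - 1)\<close> up by one, so that at \<open>x\<close> they agree with the maps
  counted by \<open>Omega (t + 1)\<close>. The pointwise minimum of two such maps is counted by
  \<open>Omega t x (a + 1)\<close>, and the pointwise maximum, shifted down by one, by \<open>Omega t x a\<close>. The
  inequality is then the Ahlswede--Daykin four functions theorem, applied to indicator functions in
  a product of chains.
\<close>

text \<open>Both \<open>c - p\<close> and \<open>c - q\<close> are nonnegative; expanding their
  product and replacing \<open>p * q\<close> by \<open>c * d\<close> leaves a multiple of
  \<open>c\<close>, and a positive \<open>c\<close> cancels. If \<open>c = 0\<close>, then
  \<open>p\<close> and \<open>q\<close> vanish.\<close>

lemma four_functions_pair:
  fixes p q c d :: "'a::linordered_idom"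
  assumes "0 \<le> p" "0 \<le> q" "p \<le> c" "q \<le> c" "0 \<le> d" "p * q \<le> c * d"
  shows "p + q \<le> c + d"
proof (cases "c = 0")
  case False
  have "0 \<le> (c - p) * (c - q)" using assms by simp
  also have "\<dots> \<le> c * (c + d - p - q)" using assms(6) by (simp add: algebra_simps)
  finally have "0 \<le> c * (c + d - p - q)" .
  moreover have "0 < c" using False assms(1,3) by simp
  ultimately have "0 \<le> c + d - p - q" by (simp add: zero_le_mult_iff)
  then show ?thesis by (simp add: algebra_simps)
qed (use assms in auto)

text \<open>Expand both products into double sums and compare the terms at \<open>(x, y)\<close> and
  \<open>(y, x)\<close> together: a single term at \<open>(y, x)\<close> with \<open>x < y\<close>
  need not be dominated by its counterpart, but the symmetrised pair is.\<close>

lemma four_functions_chain: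
  fixes \<alpha> \<beta> \<gamma> \<delta> :: "'b::linorder \<Rightarrow> 'c::linordered_idom"
  assumes nonneg: "\<And>x. x \<in> S \<Longrightarrow> 0 \<le> \<alpha> x" "\<And>x. x \<in> S \<Longrightarrow> 0 \<le> \<beta> x"
      "\<And>x. x \<in> S \<Longrightarrow> 0 \<le> \<gamma> x" "\<And>x. x \<in> S \<Longrightarrow> 0 \<le> \<delta> x"
    and le: "\<And>x y. x \<in> S \<Longrightarrow> y \<in> S \<Longrightarrow> \<alpha> x * \<beta> y \<le> \<gamma> (min x y) * \<delta> (max x y)"
  shows "sum \<alpha> S * sum \<beta> S \<le> sum \<gamma> S * sum \<delta> S"
proof -
  have ordered: "\<alpha> x * \<beta> y + \<alpha> y * \<beta> x \<le> \<gamma> x * \<delta> y + \<gamma> y * \<delta> x"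
    if "x \<in> S" "y \<in> S" "x \<le> y" for x y
  \<comment> \<open>The role of \<open>c\<close> is played by
    \<open>\<gamma> x * \<delta> y\<close>: since \<open>min\<close> and \<open>max\<close> are
    symmetric, it bounds both products on the left. The bound on \<open>p * q\<close> comes from the
    diagonal cases \<open>(x, x)\<close> and \<open>(y, y)\<close>, regrouped.\<close>
  proof (rule four_functions_pair)
    have "(\<alpha> x * \<beta> x) * (\<alpha> y * \<beta> y) \<le> (\<gamma> x * \<delta> x) * (\<gamma> y * \<delta> y)"
      using le[of x x] le[of y y] nonneg that
      by (intro mult_mono[of "\<alpha> x * \<beta> x" _ "\<alpha> y * \<beta> y"]) auto
    then show "(\<alpha> x * \<beta> y) * (\<alpha> y * \<beta> x) \<le> (\<gamma> x * \<delta> y) * (\<gamma> y * \<delta> x)"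
      by (simp add: mult_ac)
  qed (use le[of x y] le[of y x] nonneg that in \<open>auto simp: min_def max_def split: if_splits\<close>)
  have pair: "\<alpha> x * \<beta> y + \<alpha> y * \<beta> x \<le> \<gamma> x * \<delta> y + \<gamma> y * \<delta> x" if "x \<in> S" "y \<in> S" for x y
    using ordered[of x y] ordered[of y x] that by (cases "x \<le> y") (auto simp: add.commute)
  have double: "(\<Sum>x\<in>S. \<Sum>y\<in>S. f x * g y + f y * g x) = 2 * (sum f S * sum g S)"
    for f g :: "'b \<Rightarrow> 'c"
  proof -
    have "(\<Sum>x\<in>S. \<Sum>y\<in>S. f y * g x) = sum f S * sum g S"
      by (subst sum.swap) (simp add: sum_product)
    then show ?thesis by (simp add: sum.distrib sum_product)
  qed
  have "2 * (sum \<alpha> S * sum \<beta> S) \<le> 2 * (sum \<gamma> S * sum \<delta> S)"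
    unfolding double[symmetric] by (intro sum_mono pair)
  then show ?thesis by simp
qed

lemma sum_PiE_insert:
  assumes "i \<notin> I"
  shows "sum f (PiE (insert i I) S) = (\<Sum>x\<in>S i. \<Sum>g\<in>PiE I S. f (g(i := x)))"
proof -
  have "sum f (PiE (insert i I) S) = (\<Sum>(x, g)\<in>S i \<times> PiE I S. f (g(i := x)))"
    unfolding PiE_insert_eq
    by (subst sum.reindex[OF inj_combinator[OF assms]]) (simp add: case_prod_unfold)
  then show ?thesis by (simp add: sum.cartesian_product)
qed

text \<open>
  The pointwise minimum and maximum of extensional functions are again extensional, since both
  take the value \<open>undefined\<close> outside the domain.
\<close>

theorem four_functions_PiE:
  fixes \<alpha> \<beta> \<gamma> \<delta> :: "('a \<Rightarrow> 'b::linorder) \<Rightarrow> 'c::linordered_idom"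
  assumes "finite I"
    and "\<And>f. f \<in> PiE I S \<Longrightarrow> 0 \<le> \<alpha> f" "\<And>f. f \<in> PiE I S \<Longrightarrow> 0 \<le> \<beta> f"
      "\<And>f. f \<in> PiE I S \<Longrightarrow> 0 \<le> \<gamma> f" "\<And>f. f \<in> PiE I S \<Longrightarrow> 0 \<le> \<delta> f"
    and "\<And>f g. f \<in> PiE I S \<Longrightarrow> g \<in> PiE I S \<Longrightarrow>
      \<alpha> f * \<beta> g \<le> \<gamma> (\<lambda>i. min (f i) (g i)) * \<delta> (\<lambda>i. max (f i) (g i))"
  shows "sum \<alpha> (PiE I S) * sum \<beta> (PiE I S) \<le> sum \<gamma> (PiE I S) * sum \<delta> (PiE I S)"
  using assms
proof (induction I arbitrary: \<alpha> \<beta> \<gamma> \<delta> rule: finite_induct)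
  case empty
  then show ?case by simp
next
  case (insert i I)
  have upd: "g(i := x) \<in> PiE (insert i I) S" if "x \<in> S i" "g \<in> PiE I S" for g x
    using that by (rule PiE_fun_upd)
  have lattice: "(\<lambda>j. h ((f(i := x)) j) ((g(i := y)) j)) = (\<lambda>j. h (f j) (g j))(i := h x y)"
    for f g :: "'a \<Rightarrow> 'b" and x y and h :: "'b \<Rightarrow> 'b \<Rightarrow> 'b"
    by auto
  show ?case
    unfolding sum_PiE_insert[OF insert.hyps(2)]
  \<comment> \<open>Summing out the coordinates in \<open>I\<close> leaves four functions of the
    value at \<open>i\<close>, a point of the chain \<open>S i\<close>. Their hypothesis on the
    chain is the induction hypothesis for the slices at \<open>x\<close>, \<open>y\<close>,
    \<open>min x y\<close> and \<open>max x y\<close>.\<close>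
  proof (rule four_functions_chain)
    fix x y assume xy: "x \<in> S i" "y \<in> S i"
    then have "min x y \<in> S i" "max x y \<in> S i" by (auto simp: min_def max_def)
    with xy show "(\<Sum>g\<in>PiE I S. \<alpha> (g(i := x))) * (\<Sum>g\<in>PiE I S. \<beta> (g(i := y)))
      \<le> (\<Sum>g\<in>PiE I S. \<gamma> (g(i := min x y))) * (\<Sum>g\<in>PiE I S. \<delta> (g(i := max x y)))"
    proof (intro insert.IH insert.prems(1-4) upd)
      fix f g assume "f \<in> PiE I S" "g \<in> PiE I S"
      with xy show "\<alpha> (f(i := x)) * \<beta> (g(i := y)) \<le>
          \<gamma> ((\<lambda>j. min (f j) (g j))(i := min x y)) * \<delta> ((\<lambda>j. max (f j) (g j))(i := max x y))"
        unfolding lattice[symmetric] by (intro insert.prems(5) upd)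
    qed
  qed (auto intro!: sum_nonneg insert.prems upd)
qed

text \<open>For indicators, the product on the left is nonzero only when \<open>f \<in> A\<close>
  and \<open>g \<in> B\<close>, and then both factors on the right equal 1.\<close>

corollary card_mult_le_PiE:
  fixes A B C D :: "('a \<Rightarrow> 'b::linorder) set"
  assumes "finite I" "\<And>i. i \<in> I \<Longrightarrow> finite (S i)"
    and sub: "A \<subseteq> PiE I S" "B \<subseteq> PiE I S" "C \<subseteq> PiE I S" "D \<subseteq> PiE I S"
    and C: "\<And>f g. f \<in> A \<Longrightarrow> g \<in> B \<Longrightarrow> (\<lambda>i. min (f i) (g i)) \<in> C"
    and D: "\<And>f g. f \<in> A \<Longrightarrow> g \<in> B \<Longrightarrow> (\<lambda>i. max (f i) (g i)) \<in> D"
  shows "card A * card B \<le> card C * card D"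
proof -
  let ?ind = "\<lambda>E f. of_bool (f \<in> E) :: int"
  have fin: "finite (PiE I S)" using assms(1,2) by (rule finite_PiE)
  have card: "sum (?ind E) (PiE I S) = int (card E)" if "E \<subseteq> PiE I S" for E
    using fin that by (simp add: Int_absorb1)
  have "sum (?ind A) (PiE I S) * sum (?ind B) (PiE I S)
      \<le> sum (?ind C) (PiE I S) * sum (?ind D) (PiE I S)"
    by (rule four_functions_PiE) (use assms(1) C D in auto)
  then have "int (card A * card B) \<le> int (card C * card D)"
    unfolding card[OF sub(1)] card[OF sub(2)] card[OF sub(3)] card[OF sub(4)] by simp
  then show ?thesis by (simp only: of_nat_le_iff)
qed

text \<open>The lower end is a parameter so that translated families can be compared inside one
  box.\<close>

definition maps_between :: "'a set \<Rightarrow> ('a \<Rightarrow> 'a \<Rightarrow> bool) \<Rightarrow> int \<Rightarrow> int \<Rightarrow> 'a \<Rightarrow> int \<Rightarrow> ('a \<Rightarrow> int) set"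
  where "maps_between X prec l u x a =
    {g \<in> X \<rightarrow>\<^sub>E {l..u}. (\<forall>v\<in>X. \<forall>w\<in>X. prec v w \<longrightarrow> g v \<le> g w) \<and> g x = a}"

lemma Omega_eq_card_maps_between:
  assumes "x \<in> X"
  shows "Omega X prec t x a = card (maps_between X prec (1 + s) (t + s) x (a + s))"
proof -
  let ?N = "{g \<in> order_preserving_maps X prec t. g x = a}"
  let ?M = "maps_between X prec (1 + s) (t + s) x (a + s)"
  have "bij_betw (\<lambda>g. \<lambda>v\<in>X. g v + s) ?N ?M"
  proof (rule bij_betw_byWitness[where f' = "\<lambda>g. \<lambda>v\<in>X. g v - s"])
    show "\<forall>g\<in>?N. (\<lambda>v\<in>X. (\<lambda>v\<in>X. g v + s) v - s) = g"
      by (auto simp: order_preserving_maps_def PiE_iff extensional_def)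
    show "\<forall>g\<in>?M. (\<lambda>v\<in>X. (\<lambda>v\<in>X. g v - s) v + s) = g"
      by (auto simp: maps_between_def PiE_iff extensional_def)
    show "(\<lambda>g. \<lambda>v\<in>X. g v + s) ` ?N \<subseteq> ?M"
      using assms by (auto simp: order_preserving_maps_def maps_between_def PiE_iff)
    show "(\<lambda>g. \<lambda>v\<in>X. g v - s) ` ?M \<subseteq> ?N"
      using assms by (auto simp: order_preserving_maps_def maps_between_def PiE_iff algebra_simps)
  qed
  then show ?thesis unfolding Omega_def by (rule bij_betw_same_card)
qed

theorem theorem4p21:
  fixes X :: "'a set" and prec :: "'a \<Rightarrow> 'a \<Rightarrow> bool" and x :: 'a and t a :: int
  assumes "finite X" and "strict_poset_on X prec" and "x \<in> X"
    and "1 < a" and "a < t"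
  shows "Omega X prec t x (a + 1) * Omega X prec t x a
       \<ge> Omega X prec (t + 1) x (a + 1) * Omega X prec (t - 1) x a"
proof -
  \<comment> \<open>All four families are normalised to take the value \<open>a + 1\<close> at
    \<open>x\<close>, so that \<open>min\<close> and \<open>max\<close> preserve this value.\<close>
  let ?M = "\<lambda>l u. maps_between X prec l u x (a + 1)"
  have sub: "?M l u \<subseteq> X \<rightarrow>\<^sub>E {1..t + 1}" if "1 \<le> l" "u \<le> t + 1" for l u
  proof -
    have "X \<rightarrow>\<^sub>E {l..u} \<subseteq> X \<rightarrow>\<^sub>E {1..t + 1}" using that by (intro PiE_mono) auto
    then show ?thesis unfolding maps_between_def by blast
  qed
  have "card (?M 1 (t + 1)) * card (?M 2 t) \<le> card (?M 1 t) * card (?M 2 (t + 1))"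
  proof (rule card_mult_le_PiE[where I = X and S = "\<lambda>_. {1..t + 1}"])
    fix f g assume "f \<in> ?M 1 (t + 1)" "g \<in> ?M 2 t"
    then have "f \<in> extensional X" "g \<in> extensional X" "f x = a + 1" "g x = a + 1"
      and bounds: "\<And>v. v \<in> X \<Longrightarrow> 1 \<le> f v \<and> f v \<le> t + 1" "\<And>v. v \<in> X \<Longrightarrow> 2 \<le> g v \<and> g v \<le> t"
      and mono: "\<And>v w. v \<in> X \<Longrightarrow> w \<in> X \<Longrightarrow> prec v w \<Longrightarrow> f v \<le> f w \<and> g v \<le> g w"
      by (auto simp: maps_between_def PiE_iff)
    \<comment> \<open>The narrower range of \<open>g\<close> supplies the sharp ends:
      \<open>g v \<le> t\<close> caps the minimum, and \<open>2 \<le> g v\<close> lifts the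
      maximum.\<close>
    moreover have "min (f v) (g v) \<in> {1..t}" "max (f v) (g v) \<in> {2..t + 1}" if "v \<in> X" for v
      using bounds[OF that] by auto
    moreover have "min (f v) (g v) \<le> min (f w) (g w)" "max (f v) (g v) \<le> max (f w) (g w)"
      if "v \<in> X" "w \<in> X" "prec v w" for v w
      using mono[OF that] by (auto intro: min.mono max.mono)
    ultimately show "(\<lambda>v. min (f v) (g v)) \<in> ?M 1 t" "(\<lambda>v. max (f v) (g v)) \<in> ?M 2 (t + 1)"
      by (simp_all add: maps_between_def PiE_iff extensional_def)
  qed (use assms(1) sub in auto)
  then show ?thesis
    \<comment> \<open>Shift 0 gives the two families starting at 1, shift 1 the two starting at
      2.\<close>
    using Omega_eq_card_maps_between[OF assms(3), of prec "t + 1" "a + 1" 0]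
      Omega_eq_card_maps_between[OF assms(3), of prec t "a + 1" 0]
      Omega_eq_card_maps_between[OF assms(3), of prec "t - 1" a 1]
      Omega_eq_card_maps_between[OF assms(3), of prec t a 1]
    by simp
qed

end
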